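(* For a prime $p$ and integers $m\ge1$, $n'\ge0$, let $$f_0(p,m,n')=\frac{[p,n'+m]}{[p,n']}=\prod_{j=n'+1}^{n'+m}(1-p^{-j}).$$ Then $f_0(p,m,n')$ is strictly increasing in $p$ and in $n'$, strictly decreasing in $m$, and satisfies $$\lim_{m\to\infty}f_0(p,m,n')=\frac{C_p}{[p,n']}<1,\qquad\lim_{n'\to\infty}\inf_mf_0(p,m,n')=1,\qquad\lim_{p\to\infty}\inf_{m,n'}f_0(p,m,n')=1.$$ In particular, $$\lim_{m\to\infty}f_0(p,m,0)=C_p,\qquad\lim_{n'\to\infty}f_0(p,m,n')=1=\lim_{p\to\infty}f_0(p,m,n');$$ the first equality characterizes $C_p$ as the limit, as $m\to\infty$, of the probability that a random $m\times m$ matrix over $\mathbb{Z}/p^s\mathbb{Z}$ is nonsingular.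
   Context: $[p,0]=1$, $[p,\ell]=\prod_{j=1}^{\ell}(1-p^{-j})$ for $\ell\ge1$, and $C_p=\prod_{j=1}^{\infty}(1-p^{-j})$. The limit $p\to\infty$ is over primes; $s$ is any positive integer. A random matrix over $\mathbb{Z}/p^s\mathbb{Z}$ has independent uniform entries, and nonsingular means that all diagonal entries of its Smith normal form are units (i.e. the matrix is invertible). $f_0(p,m,n')$ is the probability that a random $(n'+m)\times m$ matrix over $\mathbb{Z}/p^s\mathbb{Z}$ has Smith normal form with all $m$ diagonal entries equal to $1$ up to units (it is independent of $s$). *)

theory Defs
  imports "HOL-Probability.Probability" "Berlekamp_Zassenhaus.Finite_Field" "Jordan_Normal_Form.Matrix"
begin

text \<open>$[p,\ell]$; the empty product gives $[p,0] = 1$.\<close>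

definition qbr :: "nat \<Rightarrow> nat \<Rightarrow> real" where
  "qbr p l = (\<Prod>j=1..l. 1 - 1 / real p ^ j)"

text \<open>$C_p$; \<^const>\<open>prodinf\<close> starts at index 0, hence the shift by \<^const>\<open>Suc\<close>.\<close>

definition qbr_inf :: "nat \<Rightarrow> real" where
  "qbr_inf p = prodinf (\<lambda>j. 1 - 1 / real p ^ Suc j)"

definition f0 :: "nat \<Rightarrow> nat \<Rightarrow> nat \<Rightarrow> real" where
  "f0 p m n = qbr p (n + m) / qbr p n"

definition primes_at_top :: "nat filter" where
  "primes_at_top = inf at_top (principal {p. prime p})"

definition smith_normal_form :: "'a::comm_ring_1 mat \<Rightarrow> 'a mat \<Rightarrow> bool" where
  "smith_normal_form A D \<longleftrightarrow>
     (\<exists>P Q. P \<in> carrier_mat (dim_row A) (dim_row A) \<and> invertible_mat P \<and>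
            Q \<in> carrier_mat (dim_col A) (dim_col A) \<and> invertible_mat Q \<and> D = P * A * Q) \<and>
     diagonal_mat D \<and>
     (\<forall>i. Suc i < min (dim_row A) (dim_col A) \<longrightarrow> D $$ (i, i) dvd D $$ (Suc i, Suc i))"

text \<open>All diagonal entries of the Smith normal form are units (equivalently, equal 1 up to units).
  Over $\mathbb{Z}/p^s$ a Smith normal form exists and its diagonal entries are unique up to
  units, so asking for one suitable form is the same as asking it of every form.\<close>

definition unit_smith_form :: "'a::comm_ring_1 mat \<Rightarrow> bool" where
  "unit_smith_form A \<longleftrightarrow>
     (\<exists>D. smith_normal_form A D \<and> (\<forall>i < min (dim_row A) (dim_col A). D $$ (i, i) dvd 1))"

definition nonsingular :: "'a::comm_ring_1 mat \<Rightarrow> bool" where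
  "nonsingular A \<longleftrightarrow> square_mat A \<and> unit_smith_form A"

text \<open>A matrix with independent uniform entries; the default value 0 of \<^const>\<open>Pi_pmf\<close> is used only
  outside the index range.\<close>

definition random_mat :: "nat \<Rightarrow> nat \<Rightarrow> 'a::{finite,zero} mat pmf" where
  "random_mat nr nc =
     map_pmf (Matrix.mat nr nc) (Pi_pmf ({..<nr} \<times> {..<nc}) 0 (\<lambda>_. pmf_of_set UNIV))"

end

theory Submission
  imports Defs "Berlekamp_Zassenhaus.Berlekamp_Type_Based" "HOL-Real_Asymp.Real_Asymp"
begin

text \<open>The product formula cancels the common factors of $[p,n+m]$ and $[p,n]$, and exhibits $f_0$ as a
  product of $m$ factors $1 - p^{-j}$, each in $(0,1)$ and increasing in $p$ and $j$. Monotonicity is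
  read off factor by factor. The limits follow by squeezing: the infimum over $m$ is at least the
  limit $C_p/[p,n]$ of a decreasing sequence, which tends to $1$ with $n$ because $C_p \ne 0$
  (\<open>qbr_ratio_tendsto_1\<close>), and the Weierstrass product inequality gives the bound $1 - 1/(p-1)$ for
  all $m$ and $n$ at once (\<open>f0_lower_bound\<close>).

  For the probabilistic meaning, let $R$ be a finite local ring such as $\mathbb{Z}/p^s$. A matrix
  with at least as many rows as columns has a Smith form with unit diagonal exactly when it has a left
  inverse (\<open>unit_smith_form_iff_left_invertible\<close>). Such a matrix has a unit entry in its first
  column; completing this column to an invertible matrix and dividing by it leaves a block matrix
  with rows $(1, r)$ and $(0, A)$, where $r$ is arbitrary and $A$ is again left invertible. The
  resulting bijection (\<open>card_left_invertible_Suc\<close>) shows that passing from $A$ to a matrix with one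
  more row and column multiplies the probability by the chance $1 - (u/q)^N$ that a random vector of
  the new length $N$ has a unit entry, where $u$ of the $q$ ring elements are nonunits. For
  $\mathbb{Z}/p^s$ the quotient $u/q$ is $1/p$, independently of $s$.\<close>

(* The infix dollar sign then denotes only entries of vectors whose length is not part of the type. *)
unbundle no vec_syntax

section \<open>Monotonicity and limits of the product\<close>

lemma qbr_factor_bounds:
  assumes "p \<ge> 2" "j \<ge> 1"
  shows "0 < 1 - 1 / real p ^ j" "1 - 1 / real p ^ j < 1"
proof -
  have "(1::real) < real p ^ j" using assms by (intro one_less_power) auto
  moreover from this have "0 < real p ^ j" by linarith
  ultimately have "0 < 1 / real p ^ j" "1 / real p ^ j < 1"
    by (simp_all only: zero_less_divide_1_iff divide_less_eq_1_pos)
  then show "0 < 1 - 1 / real p ^ j" "1 - 1 / real p ^ j < 1" by linarith+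
qed

lemma qbr_pos: "p \<ge> 2 \<Longrightarrow> qbr p l > 0"
  unfolding qbr_def by (intro prod_pos ballI qbr_factor_bounds) auto

lemma f0_eq_prod:
  assumes "p \<ge> 2"
  shows "f0 p m n = (\<Prod>j=n+1..n+m. 1 - 1 / real p ^ j)"
proof -
  have "qbr p (n + m) = qbr p n * (\<Prod>j=n+1..n+m. 1 - 1 / real p ^ j)"
    unfolding qbr_def by (rule prod.ub_add_nat) simp
  then show ?thesis using qbr_pos[OF assms, of n] by (simp add: f0_def)
qed

text \<open>All products run over the same index set here, so that they can be compared factor by factor
  as $n$ varies.\<close>

lemma f0_eq_prod_shift:
  assumes "p \<ge> 2"
  shows "f0 p m n = (\<Prod>j=1..m. 1 - 1 / real p ^ (j + n))"
  unfolding f0_eq_prod[OF assms]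
  using prod.shift_bounds_cl_nat_ivl[of "\<lambda>j. 1 - 1 / real p ^ j" 1 n m] by (simp add: add.commute)

lemma f0_pos: "p \<ge> 2 \<Longrightarrow> f0 p m n > 0"
  by (simp add: f0_def qbr_pos)

lemma f0_le_1:
  assumes "p \<ge> 2"
  shows "f0 p m n \<le> 1"
  unfolding f0_eq_prod[OF assms]
proof (intro prod_le_1)
  fix j assume "j \<in> {n+1..n+m}"
  then have "j \<ge> 1" by simp
  from qbr_factor_bounds[OF assms this]
  show "0 \<le> 1 - 1 / real p ^ j \<and> 1 - 1 / real p ^ j \<le> 1" by linarith
qed

lemma f0_strict_mono_p:
  assumes "p \<ge> 2" "p < q" "m \<ge> 1"
  shows "f0 p m n < f0 q m n"
proof -
  have q: "q \<ge> 2" using assms by simp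
  have less: "1 - 1 / real p ^ j < 1 - 1 / real q ^ j" if "j \<ge> 1" for j
  proof -
    have "real p ^ j < real q ^ j" using assms that by (intro power_strict_mono) auto
    then show ?thesis using assms by (simp add: frac_less2)
  qed
  show ?thesis
    unfolding f0_eq_prod[OF assms(1)] f0_eq_prod[OF q]
  proof (rule prod_mono_strict[of "n + 1"])
    fix j assume "j \<in> {n+1..n+m}"
    then have "j \<ge> 1" by simp
    then show "0 \<le> 1 - 1 / real p ^ j \<and> 1 - 1 / real p ^ j \<le> 1 - 1 / real q ^ j"
      "0 < 1 - 1 / real q ^ j"
      using less[of j] qbr_factor_bounds(1)[OF assms(1), of j] qbr_factor_bounds(1)[OF q, of j]
      by (linarith | (intro conjI; linarith))+
  qed (use assms less[of "n + 1"] in simp_all)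
qed

lemma f0_strict_mono_n:
  assumes "p \<ge> 2" "n < n'" "m \<ge> 1"
  shows "f0 p m n < f0 p m n'"
proof -
  have less: "1 - 1 / real p ^ (j + n) < 1 - 1 / real p ^ (j + n')" for j
  proof -
    have "real p ^ (j + n) < real p ^ (j + n')"
      using assms by (intro power_strict_increasing) auto
    then show ?thesis using assms by (simp add: frac_less2)
  qed
  show ?thesis
    unfolding f0_eq_prod_shift[OF assms(1)]
  proof (rule prod_mono_strict[of 1])
    fix j :: nat assume "j \<in> {1..m}"
    then have "j \<ge> 1" by simp
    then show "0 \<le> 1 - 1 / real p ^ (j + n) \<and> 1 - 1 / real p ^ (j + n) \<le> 1 - 1 / real p ^ (j + n')"
      "0 < 1 - 1 / real p ^ (j + n')"
      using less[of j] qbr_factor_bounds(1)[OF assms(1), of "j + n"]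
        qbr_factor_bounds(1)[OF assms(1), of "j + n'"]
      by (linarith | (intro conjI; linarith))+
  qed (use assms less[of 1] in simp_all)
qed

lemma f0_strict_antimono_m:
  assumes "p \<ge> 2" "m < m'"
  shows "f0 p m' n < f0 p m n"
proof -
  have step: "f0 p (Suc k) n < f0 p k n" for k
  proof -
    have "f0 p (Suc k) n = f0 p k n * (1 - 1 / real p ^ (n + Suc k))"
      by (simp add: f0_def qbr_def)
    also have "\<dots> < f0 p k n * 1"
      using f0_pos[OF assms(1)] qbr_factor_bounds[OF assms(1), of "n + Suc k"]
      by (intro mult_strict_left_mono) auto
    finally show ?thesis by simp
  qed
  have "- f0 p m n < - f0 p m' n"
    by (rule lift_Suc_mono_less[OF _ assms(2)]) (simp add: step)
  then show ?thesis by simp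
qed

text \<open>The defects $p^{-j}$ form a geometric series, so the infinite product converges absolutely; in
  particular its value $C_p$ is nonzero, which is what drives the limit in $n$.\<close>

lemma convergent_prod_qbr:
  assumes "p \<ge> 2"
  shows "convergent_prod (\<lambda>j. 1 - 1 / real p ^ Suc j)"
proof (rule abs_convergent_prod_imp_convergent_prod)
  have "summable (\<lambda>j. (1 / real p) ^ Suc j)"
    using assms by (subst summable_Suc_iff) (auto intro!: summable_geometric)
  then show "abs_convergent_prod (\<lambda>j. 1 - 1 / real p ^ Suc j)"
    unfolding abs_convergent_prod_conv_summable by (simp add: power_divide)
qed

lemma qbr_tendsto:
  assumes "p \<ge> 2"
  shows "qbr p \<longlonglongrightarrow> qbr_inf p"
proof -
  have "qbr p (Suc k) = (\<Prod>i\<le>k. 1 - 1 / real p ^ Suc i)" for k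
    unfolding qbr_def
    by (rule prod.reindex_bij_witness[of _ Suc "\<lambda>j. j - 1"]) auto
  then have "(\<lambda>k. qbr p (Suc k)) \<longlonglongrightarrow> qbr_inf p"
    using convergent_prod_LIMSEQ[OF convergent_prod_qbr[OF assms]] by (simp add: qbr_inf_def)
  then show ?thesis by (rule LIMSEQ_imp_Suc)
qed

lemma qbr_inf_nonzero:
  assumes "p \<ge> 2"
  shows "qbr_inf p \<noteq> 0"
  unfolding qbr_inf_def
proof (rule prodinf_nonzero[OF convergent_prod_qbr[OF assms]])
  show "1 - 1 / real p ^ Suc i \<noteq> 0" for i
    using qbr_factor_bounds(1)[OF assms, of "Suc i"] by linarith
qed

lemma f0_tendsto_m:
  assumes "p \<ge> 2"
  shows "(\<lambda>k. f0 p k n) \<longlonglongrightarrow> qbr_inf p / qbr p n"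
proof -
  have "(\<lambda>k. qbr p (k + n)) \<longlonglongrightarrow> qbr_inf p"
    by (rule LIMSEQ_ignore_initial_segment[OF qbr_tendsto[OF assms]])
  then show ?thesis
    unfolding f0_def using qbr_pos[OF assms, of n]
    by (auto intro!: tendsto_divide simp: add.commute)
qed

text \<open>The sequence in $m$ decreases to this value, which is therefore a lower bound uniform in $m$.\<close>

lemma qbr_ratio_le_f0:
  assumes "p \<ge> 2"
  shows "qbr_inf p / qbr p n \<le> f0 p m n"
proof (rule LIMSEQ_le_const2[OF f0_tendsto_m[OF assms]])
  show "\<exists>N. \<forall>k\<ge>N. f0 p k n \<le> f0 p m n"
    using f0_strict_antimono_m[OF assms, of m _ n]
    by (intro exI[of _ m]) (metis le_less order_refl)
qed

lemma qbr_ratio_less_1: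
  assumes "p \<ge> 2"
  shows "qbr_inf p / qbr p n < 1"
proof -
  have "f0 p 1 n < f0 p 0 n" by (rule f0_strict_antimono_m[OF assms]) simp
  also have "\<dots> = 1" using qbr_pos[OF assms, of n] by (simp add: f0_def)
  finally show ?thesis using qbr_ratio_le_f0[OF assms, of n 1] by simp
qed

lemma qbr_ratio_tendsto_1:
  assumes "p \<ge> 2"
  shows "(\<lambda>n. qbr_inf p / qbr p n) \<longlonglongrightarrow> 1"
  using tendsto_divide[OF tendsto_const qbr_tendsto[OF assms] qbr_inf_nonzero[OF assms], of "qbr_inf p"]
    qbr_inf_nonzero[OF assms] by simp

lemma INF_f0_tendsto_n:
  assumes "p \<ge> 2"
  shows "(\<lambda>k. INF i\<in>{1..}. f0 p i k) \<longlonglongrightarrow> 1"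
proof (rule tendsto_sandwich[OF _ _ qbr_ratio_tendsto_1[OF assms] tendsto_const])
  show "\<forall>\<^sub>F k in sequentially. qbr_inf p / qbr p k \<le> (INF i\<in>{1..}. f0 p i k)"
    using qbr_ratio_le_f0[OF assms] by (intro always_eventually allI cINF_greatest) auto
  have "(INF i\<in>{1..}. f0 p i k) \<le> f0 p 1 k" for k
    by (rule cINF_lower) (use f0_pos[OF assms] in \<open>auto intro!: bdd_belowI2 less_imp_le\<close>)
  then show "\<forall>\<^sub>F k in sequentially. (INF i\<in>{1..}. f0 p i k) \<le> 1"
    using f0_le_1[OF assms] by (intro always_eventually allI) (meson order_trans)
qed

lemma f0_tendsto_n:
  assumes "p \<ge> 2"
  shows "(\<lambda>k. f0 p m k) \<longlonglongrightarrow> 1"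
  by (rule tendsto_sandwich[OF _ _ qbr_ratio_tendsto_1[OF assms] tendsto_const])
    (auto intro!: always_eventually qbr_ratio_le_f0 f0_le_1 assms)

text \<open>A bound uniform in $m$ and $n$: by the Weierstrass product inequality the product is at least
  one minus the sum of the defects $p^{-(j+n)} \<le> p^{-j}$, and the whole series $\sum_{j \ge 1} p^{-j}$ is $1/(p-1)$.\<close>

lemma f0_lower_bound:
  assumes "p \<ge> 2"
  shows "1 - 1 / (real p - 1) \<le> f0 p m n"
proof -
  have geo: "(\<lambda>j. (1 / real p) ^ Suc j) sums (1 / (real p - 1))"
  proof -
    have "(\<lambda>j. (1 / real p) * (1 / real p) ^ j) sums ((1 / real p) * (1 / (1 - 1 / real p)))"
      by (intro sums_mult geometric_sums) (use assms in auto)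
    moreover have "(1 / real p) * (1 / (1 - 1 / real p)) = 1 / (real p - 1)"
      using assms by (simp add: field_simps)
    ultimately show ?thesis by (simp only: power_Suc)
  qed
  have "(\<Sum>j=1..m. 1 / real p ^ (j + n)) \<le> (\<Sum>j=1..m. (1 / real p) ^ j)"
  proof (rule sum_mono)
    fix j
    have "real p ^ j \<le> real p ^ (j + n)" using assms by (intro power_increasing) auto
    then show "1 / real p ^ (j + n) \<le> (1 / real p) ^ j"
      using assms by (simp add: power_divide frac_le)
  qed
  also have "\<dots> = (\<Sum>j<m. (1 / real p) ^ Suc j)"
    by (rule sum.reindex_bij_witness[of _ Suc "\<lambda>j. j - 1"]) auto
  also have "\<dots> \<le> 1 / (real p - 1)"
    using sum_le_suminf[OF sums_summable[OF geo], of "{..<m}"] sums_unique[OF geo] by simp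
  finally have "1 - 1 / (real p - 1) \<le> 1 - (\<Sum>j=1..m. 1 / real p ^ (j + n))" by simp
  also have "\<dots> \<le> (\<Prod>j=1..m. 1 - 1 / real p ^ (j + n))"
  proof (rule Weierstrass_prod_ineq)
    fix j :: nat assume "j \<in> {1..m}"
    then show "1 / real p ^ (j + n) \<in> {0..1}"
      using less_imp_le[OF qbr_factor_bounds(1)[OF assms, of "j + n"]] by simp
  qed
  finally show ?thesis by (simp only: f0_eq_prod_shift[OF assms])
qed

lemma f0_lower_bound_tendsto: "((\<lambda>q. 1 - 1 / (real q - 1)) \<longlongrightarrow> 1) primes_at_top"
proof (rule tendsto_mono)
  show "primes_at_top \<le> at_top" by (simp add: primes_at_top_def)
  show "((\<lambda>q. 1 - 1 / (real q - 1)) \<longlongrightarrow> 1) at_top" by real_asymp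
qed

lemma eventually_prime_at_top: "\<forall>\<^sub>F q in primes_at_top. prime q"
  by (simp add: primes_at_top_def eventually_inf_principal)

lemma f0_tendsto_p: "((\<lambda>q. f0 q m n) \<longlongrightarrow> 1) primes_at_top"
  by (rule tendsto_sandwich[OF _ _ f0_lower_bound_tendsto tendsto_const];
      rule eventually_mono[OF eventually_prime_at_top])
    (auto intro: f0_lower_bound f0_le_1 prime_ge_2_nat)

lemma INF_f0_tendsto_p: "((\<lambda>q. INF (i, k)\<in>{1..} \<times> UNIV. f0 q i k) \<longlongrightarrow> 1) primes_at_top"
proof (rule tendsto_sandwich[OF _ _ f0_lower_bound_tendsto tendsto_const];
    rule eventually_mono[OF eventually_prime_at_top])
  fix q :: nat assume "prime q"
  then have q: "q \<ge> 2" by (rule prime_ge_2_nat)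
  show "1 - 1 / (real q - 1) \<le> (INF (i, k)\<in>{1..} \<times> UNIV. f0 q i k)"
    using f0_lower_bound[OF q] by (intro cINF_greatest) auto
  have "(INF (i, k)\<in>{1..} \<times> UNIV. f0 q i k) \<le> (case (1, 0) of (i, k) \<Rightarrow> f0 q i k)"
    by (rule cINF_lower) (use f0_pos[OF q] in \<open>auto intro!: bdd_belowI2 less_imp_le\<close>)
  then show "(INF (i, k)\<in>{1..} \<times> UNIV. f0 q i k) \<le> 1"
    using f0_le_1[OF q, of 1 0] by simp
qed

section \<open>Left invertible matrices over a commutative ring\<close>

definition left_invertible :: "'a::comm_ring_1 mat \<Rightarrow> bool" where
  "left_invertible A \<longleftrightarrow> (\<exists>B \<in> carrier_mat (dim_col A) (dim_row A). B * A = 1\<^sub>m (dim_col A))"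

lemma left_invertibleI:
  assumes "A \<in> carrier_mat n m" "B \<in> carrier_mat m n" "B * A = 1\<^sub>m m"
  shows "left_invertible A"
  using assms by (auto simp: left_invertible_def)

lemma left_invertibleE:
  assumes "left_invertible A" "A \<in> carrier_mat n m"
  obtains B where "B \<in> carrier_mat m n" "B * A = 1\<^sub>m m"
  using assms by (auto simp: left_invertible_def)

lemma invertible_matI:
  assumes "P \<in> carrier_mat n n" "Q \<in> carrier_mat n n" "P * Q = 1\<^sub>m n" "Q * P = 1\<^sub>m n"
  shows "invertible_mat P"
  using assms by (auto simp: invertible_mat_def inverts_mat_def)

lemma invertible_matE:
  assumes "invertible_mat P" "P \<in> carrier_mat n n"
  obtains Q where "Q \<in> carrier_mat n n" "P * Q = 1\<^sub>m n" "Q * P = 1\<^sub>m n"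
proof -
  obtain Q where Q: "P * Q = 1\<^sub>m (dim_row P)" "Q * P = 1\<^sub>m (dim_row Q)"
    using assms(1) by (auto simp: invertible_mat_def inverts_mat_def)
  have "dim_row Q = n" "dim_col Q = n"
    using arg_cong[OF Q(1), of dim_col] arg_cong[OF Q(2), of dim_col] assms(2) by auto
  with Q assms(2) that[of Q] show thesis by auto
qed

lemma left_invertible_mult_left_iff:
  assumes "invertible_mat P" "P \<in> carrier_mat n n" "A \<in> carrier_mat n m"
  shows "left_invertible (P * A) \<longleftrightarrow> left_invertible A"
proof -
  obtain Q where Q: "Q \<in> carrier_mat n n" "P * Q = 1\<^sub>m n" "Q * P = 1\<^sub>m n"
    using invertible_matE[OF assms(1,2)] by blast
  have imp: "left_invertible (X * C)"
    if X: "left_invertible C" "X \<in> carrier_mat n n" "Y \<in> carrier_mat n n" "Y * X = 1\<^sub>m n"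
      "C \<in> carrier_mat n m" for X Y C :: "'a mat"
  proof -
    obtain B where B: "B \<in> carrier_mat m n" "B * C = 1\<^sub>m m"
      using left_invertibleE[OF X(1,5)] by blast
    have "(B * Y) * (X * C) = B * ((Y * X) * C)"
      using B X(2,3,5) by (simp add: assoc_mult_mat[of _ _ n _ n _ m] assoc_mult_mat[of _ _ n _ n _ n])
    also have "\<dots> = 1\<^sub>m m" using X B by simp
    finally show ?thesis
      using left_invertibleI[of "X * C" n m "B * Y"] B X by auto
  qed
  have "Q * (P * A) = A"
    using Q assms by (simp flip: assoc_mult_mat[of Q n n P n A m])
  then show ?thesis
    using imp[of A P Q] imp[of "P * A" Q P] Q assms by auto
qed

lemma mult_mat_unit_vec:
  fixes A :: "'a::semiring_1 mat"
  assumes "A \<in> carrier_mat n m" "j < m"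
  shows "A *\<^sub>v unit_vec m j = col A j"
  using assms by (intro eq_vecI) auto

text \<open>The block matrix with rows $(1, r)$ and $(0, A)$: what remains of a matrix whose first column
  has been cleared to the first unit vector.\<close>

definition bordered :: "'a::comm_ring_1 mat \<Rightarrow> 'a mat \<Rightarrow> 'a mat" where
  "bordered r A = four_block_mat (1\<^sub>m 1) r (0\<^sub>m (dim_row A) 1) A"

lemma bordered_carrier:
  "A \<in> carrier_mat n m \<Longrightarrow> bordered r A \<in> carrier_mat (Suc n) (Suc m)"
  using four_block_carrier_mat[of "1\<^sub>m 1" 1 1 A n m] by (simp add: bordered_def)

text \<open>Bordered matrices multiply like affine maps. Clearing the row $r$ and inverting a bordered
  matrix are both instances of this one formula.\<close>

lemma bordered_mult:
  assumes "r \<in> carrier_mat 1 n" "A \<in> carrier_mat l n" "s \<in> carrier_mat 1 m" "B \<in> carrier_mat n m"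
  shows "bordered r A * bordered s B = bordered (s + r * B) (A * B)"
proof -
  have "bordered r A * bordered s B =
      four_block_mat (1\<^sub>m 1 * 1\<^sub>m 1 + r * 0\<^sub>m n 1) (1\<^sub>m 1 * s + r * B)
        (0\<^sub>m l 1 * 1\<^sub>m 1 + A * 0\<^sub>m n 1) (0\<^sub>m l 1 * s + A * B)"
    unfolding bordered_def using assms by (subst mult_four_block_mat) auto
  also have "\<dots> = bordered (s + r * B) (A * B)"
    using assms by (simp add: bordered_def)
  finally show ?thesis .
qed

lemma bordered_zero_one: "bordered (0\<^sub>m 1 n) (1\<^sub>m n) = 1\<^sub>m (Suc n)"
  using four_block_one_mat[of 1 n] by (simp add: bordered_def)

lemma bordered_eq_iff:
  assumes "r \<in> carrier_mat 1 m" "A \<in> carrier_mat n m" "s \<in> carrier_mat 1 m" "B \<in> carrier_mat n m"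
  shows "bordered r A = bordered s B \<longleftrightarrow> r = s \<and> A = B"
proof
  assume eq: "bordered r A = bordered s B"
  have idx: "bordered r A $$ (i, j) = bordered s B $$ (i, j)" for i j by (simp add: eq)
  have "r = s"
  proof (rule eq_matI)
    fix i j assume "i < dim_row s" "j < dim_col s"
    then show "r $$ (i, j) = s $$ (i, j)"
      using idx[of 0 "Suc j"] assms by (auto simp: bordered_def)
  qed (use assms in auto)
  moreover have "A = B"
  proof (rule eq_matI)
    fix i j assume "i < dim_row B" "j < dim_col B"
    then show "A $$ (i, j) = B $$ (i, j)"
      using idx[of "Suc i" "Suc j"] assms by (auto simp: bordered_def)
  qed (use assms in auto)
  ultimately show "r = s \<and> A = B" ..
qed simp

lemma col_bordered:
  assumes "A \<in> carrier_mat n m"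
  shows "col (bordered r A) 0 = unit_vec (Suc n) 0"
  using assms by (intro eq_vecI) (auto simp: bordered_def)

lemma bordered_exhaust:
  assumes "M \<in> carrier_mat (Suc n) (Suc m)" "col M 0 = unit_vec (Suc n) 0"
  obtains r A where "r \<in> carrier_mat 1 m" "A \<in> carrier_mat n m" "M = bordered r A"
proof -
  have col: "M $$ (i, 0) = (if i = 0 then 1 else 0)" if "i < Suc n" for i
    using arg_cong[OF assms(2), of "\<lambda>v. v $ i"] assms(1) that by (auto simp: unit_vec_def)
  show thesis
  proof (rule that)
    show "M = bordered (Matrix.mat 1 m (\<lambda>(i, j). M $$ (0, Suc j)))
        (Matrix.mat n m (\<lambda>(i, j). M $$ (Suc i, Suc j)))" (is "_ = ?K")
    proof (rule eq_matI)
      fix i j assume "i < dim_row ?K" "j < dim_col ?K"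
      then show "M $$ (i, j) = ?K $$ (i, j)"
        using col[of i] by (cases i; cases j) (auto simp: bordered_def)
    qed (use assms in \<open>auto simp: bordered_def\<close>)
  qed auto
qed

text \<open>A left inverse of a bordered matrix must itself fix the first unit vector, hence is bordered,
  and its lower block inverts $A$ on the left. Conversely a left inverse $B$ of $A$ extends by the
  first row $(1, -rB)$.\<close>

lemma left_invertible_bordered_iff:
  assumes r: "r \<in> carrier_mat 1 m" and A: "A \<in> carrier_mat n m"
  shows "left_invertible (bordered r A) \<longleftrightarrow> left_invertible A"
proof
  assume "left_invertible (bordered r A)"
  then obtain B where B: "B \<in> carrier_mat (Suc m) (Suc n)" "B * bordered r A = 1\<^sub>m (Suc m)"
    using left_invertibleE bordered_carrier[OF A] by blast
  have "col B 0 = B *\<^sub>v unit_vec (Suc n) 0"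
    using B(1) by (simp add: mult_mat_unit_vec)
  also have "\<dots> = col (B * bordered r A) 0"
    using col_mult2[OF B(1) bordered_carrier[OF A], of 0 r] col_bordered[OF A] by simp
  also have "\<dots> = unit_vec (Suc m) 0" by (simp add: B(2))
  finally obtain s C where C: "s \<in> carrier_mat 1 n" "C \<in> carrier_mat m n" "B = bordered s C"
    using bordered_exhaust[OF B(1)] by blast
  have "bordered (r + s * A) (C * A) = bordered (0\<^sub>m 1 m) (1\<^sub>m m)"
    using B(2) by (simp only: C(3) bordered_mult[OF C(1,2) r A] bordered_zero_one)
  then have "C * A = 1\<^sub>m m"
    using bordered_eq_iff[of "r + s * A" m "C * A" m "0\<^sub>m 1 m" "1\<^sub>m m"] r A C by auto
  then show "left_invertible A" using left_invertibleI[OF A C(2)] by blast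
next
  assume "left_invertible A"
  then obtain B where B: "B \<in> carrier_mat m n" "B * A = 1\<^sub>m m"
    using left_invertibleE A by blast
  have "bordered (- r * B) B * bordered r A = bordered (r + - r * B * A) (B * A)"
    using B r A by (intro bordered_mult) auto
  also have "- r * B * A = - r"
    using B r A by (simp add: assoc_mult_mat[of "- r" 1 m B n A m])
  also have "r + - r = 0\<^sub>m 1 m" using r by (intro eq_matI) auto
  finally show "left_invertible (bordered r A)"
    using left_invertibleI[OF bordered_carrier[OF A] bordered_carrier[OF B(1)]] B(2)
    by (simp only: bordered_zero_one)
qed

lemma invertible_bordered:
  assumes P: "P \<in> carrier_mat n n" "invertible_mat P" and s: "s \<in> carrier_mat 1 n"
  shows "invertible_mat (bordered s P)"
proof -
  obtain Q where Q: "Q \<in> carrier_mat n n" "P * Q = 1\<^sub>m n" "Q * P = 1\<^sub>m n"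
    using invertible_matE[OF P(2,1)] by blast
  have sQ: "- s * Q \<in> carrier_mat 1 n" using s Q by auto
  have "bordered s P * bordered (- s * Q) Q = bordered (- s * Q + s * Q) (P * Q)"
    using P Q s by (intro bordered_mult) auto
  also have "- s * Q + s * Q = 0\<^sub>m 1 n"
    using s Q by (intro eq_matI) auto
  finally have 1: "bordered s P * bordered (- s * Q) Q = 1\<^sub>m (Suc n)"
    by (simp only: Q bordered_zero_one)
  have "bordered (- s * Q) Q * bordered s P = bordered (s + - s * Q * P) (Q * P)"
    using P Q s by (intro bordered_mult) auto
  also have "- s * Q * P = - s"
    using P Q s by (simp add: assoc_mult_mat[of "- s" 1 n Q n P n])
  also have "s + - s = 0\<^sub>m 1 n" using s by (intro eq_matI) auto
  finally have 2: "bordered (- s * Q) Q * bordered s P = 1\<^sub>m (Suc n)"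
    by (simp only: Q bordered_zero_one)
  show ?thesis
    by (rule invertible_matI[OF bordered_carrier[OF P(1)] bordered_carrier[OF Q(1)] 1 2])
qed

lemma unit_det_invertible:
  assumes A: "A \<in> carrier_mat n n" and "det A dvd 1"
  shows "invertible_mat A"
proof -
  obtain c where c: "1 = det A * c" using assms(2) by (elim dvdE)
  let ?B = "c \<cdot>\<^sub>m adj_mat A"
  note adj = adj_mat[OF A]
  have *: "c * det A = 1" using c by (simp add: mult.commute)
  have "A * ?B = c \<cdot>\<^sub>m (A * adj_mat A)" "?B * A = c \<cdot>\<^sub>m (adj_mat A * A)"
    using A adj(1) by (simp_all add: mult_smult_distrib mult_smult_assoc_mat)
  then have "A * ?B = 1\<^sub>m n" "?B * A = 1\<^sub>m n"
    using * by (auto simp: adj intro!: eq_matI)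
  then show ?thesis using invertible_matI[OF A _ _ , of ?B] adj(1) by auto
qed

text \<open>Swap the unit entry into the corner. The identity matrix with the swapped vector as its first
  column is lower triangular with that entry as its determinant, and swapping its rows back gives
  $v$ as first column at the cost of a sign.\<close>

lemma unit_entry_extends:
  fixes v :: "'a::comm_ring_1 vec"
  assumes v: "v \<in> carrier_vec n" and i: "i < n" "v $ i dvd 1"
  obtains G where "G \<in> carrier_mat n n" "invertible_mat G" "col G 0 = v"
proof -
  define T where "T = Matrix.mat n n (\<lambda>(k, j).
    if j = 0 then v $ (if k = 0 then i else if k = i then 0 else k) else if k = j then 1 else 0)"
  have T: "T \<in> carrier_mat n n" by (simp add: T_def)
  have "det T = prod_list (diag_mat T)"
    by (rule det_lower_triangular[OF _ T]) (auto simp: T_def)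
  also have "\<dots> = (\<Prod>k<n. T $$ (k, k))"
    using T by (simp add: prod_list_diag_prod atLeast0LessThan)
  also have "\<dots> = (\<Prod>k<n. if k = 0 then v $ i else 1)"
    by (rule prod.cong) (auto simp: T_def)
  also have "\<dots> = v $ i" using i by (simp add: prod.delta)
  finally have detT: "det T = v $ i" .
  define G where "G = (if i = 0 then T else swaprows 0 i T)"
  have G: "G \<in> carrier_mat n n" using T by (simp add: G_def)
  have "det G = v $ i \<or> det G = - (v $ i)"
    using det_swaprows[of 0 n i T] T i detT by (auto simp: G_def)
  then have "det G dvd 1" using i by auto
  moreover have "col G 0 = v"
    using v i by (intro eq_vecI) (auto simp: G_def T_def)
  ultimately show thesis using that[OF G unit_det_invertible[OF G]] by blast
qed

definition identity_columns :: "nat \<Rightarrow> nat \<Rightarrow> 'a::comm_ring_1 mat" where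
  "identity_columns n m = Matrix.mat n m (\<lambda>(i, j). if i = j then 1 else 0)"

lemma identity_columns_carrier: "identity_columns n m \<in> carrier_mat n m"
  by (simp add: identity_columns_def)

lemma bordered_identity_columns:
  "bordered (0\<^sub>m 1 m) (identity_columns n m) = identity_columns (Suc n) (Suc m)"
  by (rule eq_matI) (auto simp: bordered_def identity_columns_def)

lemma invertible_mat_mult:
  assumes "A \<in> carrier_mat n n" "invertible_mat A" "B \<in> carrier_mat n n" "invertible_mat B"
  shows "invertible_mat (A * B)"
proof -
  obtain A' where A': "A' \<in> carrier_mat n n" "A * A' = 1\<^sub>m n" "A' * A = 1\<^sub>m n"
    using invertible_matE[OF assms(2,1)] by blast
  obtain B' where B': "B' \<in> carrier_mat n n" "B * B' = 1\<^sub>m n" "B' * B = 1\<^sub>m n"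
    using invertible_matE[OF assms(4,3)] by blast
  have "A * (B * (B' * A')) = A * (B * B' * A')" "B' * (A' * (A * B)) = B' * (A' * A * B)"
    using assms A'(1) B'(1) by (simp_all add: assoc_mult_mat[of _ n n _ n _ n])
  then have "A * B * (B' * A') = 1\<^sub>m n" "B' * A' * (A * B) = 1\<^sub>m n"
    using assms A' B' by (simp_all add: assoc_mult_mat[of _ n n _ n _ n])
  then show ?thesis
    using invertible_matI[of "A * B" n "B' * A'"] assms A' B' by auto
qed

text \<open>Any invertible $G$ that shares its first column with $A$ reduces the first column of $A$ to a
  unit vector. Choosing $G$ to depend only on this column is what later makes the count a
  bijection.\<close>

lemma first_column_reduction:
  assumes G: "G \<in> carrier_mat (Suc n) (Suc n)" "invertible_mat G"
    and A: "A \<in> carrier_mat (Suc n) (Suc m)" and col: "col G 0 = col A 0"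
  obtains r A' where "r \<in> carrier_mat 1 m" "A' \<in> carrier_mat n m" "A = G * bordered r A'"
proof -
  obtain H where H: "H \<in> carrier_mat (Suc n) (Suc n)" "G * H = 1\<^sub>m (Suc n)" "H * G = 1\<^sub>m (Suc n)"
    using invertible_matE[OF G(2,1)] by blast
  have "col (H * A) 0 = H *\<^sub>v col G 0" using col_mult2[OF H(1) A, of 0] col by simp
  also have "\<dots> = col (H * G) 0" using col_mult2[OF H(1) G(1), of 0] by simp
  also have "\<dots> = unit_vec (Suc n) 0" by (simp add: H)
  finally obtain r A' where *: "r \<in> carrier_mat 1 m" "A' \<in> carrier_mat n m" "H * A = bordered r A'"
    using bordered_exhaust[OF mult_carrier_mat[OF H(1) A]] by blast
  have "G * (H * A) = A"
    using assoc_mult_mat[OF G(1) H(1) A] H(2) A by simp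
  with * show thesis using that by auto
qed

section \<open>Elimination over a local ring\<close>

text \<open>Locality is used in the form that the nonunits are closed under addition.\<close>

locale local_ring =
  fixes R :: "'a::comm_ring_1 itself"
  assumes nonunit_add: "\<lbrakk>\<not> x dvd 1; \<not> y dvd 1\<rbrakk> \<Longrightarrow> \<not> (x + y :: 'a) dvd 1"
begin

lemma sum_unit_has_unit:
  fixes f :: "'b \<Rightarrow> 'a"
  assumes "finite I" "sum f I dvd 1"
  shows "\<exists>i\<in>I. f i dvd 1"
  using assms
proof (induction I rule: finite_induct)
  case (insert x I)
  then show ?case using nonunit_add[of "f x" "sum f I"] by auto
qed (use nonunit_add[of 0 0] in auto)

text \<open>The $j$-th row of a left inverse writes $1$ as a combination of the entries of column $j$; in a
  local ring one of these entries has to be a unit.\<close>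

lemma left_invertible_col_has_unit:
  fixes A :: "'a mat"
  assumes A: "A \<in> carrier_mat n m" and "left_invertible A" and j: "j < m"
  shows "\<exists>i<n. col A j $ i dvd 1"
proof -
  obtain B where B: "B \<in> carrier_mat m n" "B * A = 1\<^sub>m m"
    using left_invertibleE assms(1,2) by blast
  have "(\<Sum>i\<in>{0..<n}. row B j $ i * col A j $ i) = (B * A) $$ (j, j)"
    using A B(1) j by (simp add: scalar_prod_def)
  then have "(\<Sum>i\<in>{0..<n}. row B j $ i * col A j $ i) dvd 1"
    using B(2) j by simp
  then obtain i where "i < n" "row B j $ i * col A j $ i dvd 1"
    using sum_unit_has_unit[of "{0..<n}" "\<lambda>i. row B j $ i * col A j $ i"]
    by (metis atLeastLessThan_iff finite_atLeastLessThan)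
  then show ?thesis using dvd_mult_right by blast
qed

text \<open>Gaussian elimination by columns. Left invertibility survives each step and provides the next
  unit pivot, and row operations alone suffice: a left inverse $B$ of the remaining block $A'$ supplies the row operation that
  clears $r$: adding $-rB$ times the lower rows replaces $r$ by $r - rBA' = 0$.\<close>

lemma left_invertible_reduces:
  fixes A :: "'a mat"
  assumes "A \<in> carrier_mat n m" "left_invertible A"
  shows "\<exists>P \<in> carrier_mat n n. invertible_mat P \<and> P * A = identity_columns n m"
  using assms
proof (induction m arbitrary: n A)
  case 0
  have "1\<^sub>m n * A = identity_columns n 0"
    using 0(1) by (intro eq_matI) (auto simp: identity_columns_def)
  moreover have "invertible_mat (1\<^sub>m n :: 'a mat)"
    by (rule invertible_matI[of _ n "1\<^sub>m n"]) auto
  ultimately show ?case by (intro bexI[of _ "1\<^sub>m n"]) auto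
next
  case (Suc m N)
  \<comment> \<open>The unit pivot also shows that there is a row left to use.\<close>
  obtain i where i: "i < N" "col A 0 $ i dvd 1"
    using left_invertible_col_has_unit[OF Suc.prems, of 0] by auto
  then obtain n where N: "N = Suc n" by (cases N) auto
  have colA: "col A 0 \<in> carrier_vec N" using Suc.prems by auto
  obtain G where G: "G \<in> carrier_mat N N" "invertible_mat G" "col G 0 = col A 0"
    using unit_entry_extends[OF colA i] by blast
  then obtain r A' where A': "r \<in> carrier_mat 1 m" "A' \<in> carrier_mat n m" "A = G * bordered r A'"
    using first_column_reduction[of G n A m] Suc.prems(1) N by auto
  obtain H where H: "H \<in> carrier_mat N N" "G * H = 1\<^sub>m N" "H * G = 1\<^sub>m N"
    using invertible_matE[OF G(2,1)] by blast
  note KA = bordered_carrier[OF A'(2), of r, folded N]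
  have HA: "H * A = bordered r A'"
    using assoc_mult_mat[OF H(1) G(1) KA] A'(3) H(3) KA by simp
  have "left_invertible A'"
    using Suc.prems(2) left_invertible_mult_left_iff[OF G(2,1) KA] left_invertible_bordered_iff A' by metis
  then obtain P B where P: "P \<in> carrier_mat n n" "invertible_mat P" "P * A' = identity_columns n m"
    and B: "B \<in> carrier_mat m n" "B * A' = 1\<^sub>m m"
    using Suc.IH[OF A'(2)] left_invertibleE[OF _ A'(2)] by metis
  let ?K = "bordered (- r * B) P"
  have rB: "- r * B \<in> carrier_mat 1 n" using A' B by auto
  note K = bordered_carrier[OF P(1), of "- r * B", folded N]
  have "?K * bordered r A' = bordered (r + - r * B * A') (P * A')"
    using A' P by (intro bordered_mult[OF rB]) auto
  also have "- r * B * A' = - r"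
    using B A' by (simp add: assoc_mult_mat[of "- r" 1 m B n A' m])
  also have "r + - r = 0\<^sub>m 1 m" using A'(1) by (intro eq_matI) auto
  finally have KK: "?K * bordered r A' = identity_columns N (Suc m)"
    by (simp only: P bordered_identity_columns N)
  have "(?K * H) * A = identity_columns N (Suc m)"
    using assoc_mult_mat[OF K H(1) Suc.prems(1)] HA KK by simp
  moreover have "invertible_mat (?K * H)"
    using invertible_mat_mult[OF K invertible_bordered[OF P(1,2) rB] H(1)]
      invertible_matI[OF H(1) G(1) H(3,2)] by blast
  ultimately show ?case using K H(1) by (intro bexI[of _ "?K * H"]) auto
qed

text \<open>A diagonal form with unit diagonal has an evident left inverse $E$, and $E P A Q = 1$ gives
  $(Q E P) A = 1$ after conjugation by $Q$. The converse is the reduction above, with trivial column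
  operations. The hypothesis $m \le n$ matters in the first direction: a wide matrix may have
  a unit Smith form without being left invertible.\<close>

lemma unit_smith_form_iff_left_invertible:
  fixes A :: "'a mat"
  assumes A: "A \<in> carrier_mat n m" and "m \<le> n"
  shows "unit_smith_form A \<longleftrightarrow> left_invertible A"
proof
  assume "unit_smith_form A"
  then obtain P Q where P: "P \<in> carrier_mat n n" and Q: "Q \<in> carrier_mat m m" "invertible_mat Q"
    and diag: "diagonal_mat (P * A * Q)"
    and units: "\<forall>i<m. (P * A * Q) $$ (i, i) dvd 1"
    using A \<open>m \<le> n\<close> by (auto simp: unit_smith_form_def smith_normal_form_def)
  define D where "D = P * A * Q"
  have D: "D \<in> carrier_mat n m" using P A Q by (auto simp: D_def)
  have "\<forall>i<m. \<exists>c. D $$ (i, i) * c = 1" using units unfolding D_def by (metis dvdE)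
  then obtain c where c: "\<And>i. i < m \<Longrightarrow> D $$ (i, i) * c i = 1" by metis
  define E where "E = Matrix.mat m n (\<lambda>(i, j). if i = j then c i else 0)"
  have E: "E \<in> carrier_mat m n" by (simp add: E_def)
  have "E * D = 1\<^sub>m m"
  proof (rule eq_matI)
    fix i j assume "i < dim_row (1\<^sub>m m :: 'a mat)" "j < dim_col (1\<^sub>m m :: 'a mat)"
    then have ij: "i < m" "j < m" "i < n" "j < n" using \<open>m \<le> n\<close> by auto
    have "(E * D) $$ (i, j) = (\<Sum>k\<in>{0..<n}. (if i = k then c i else 0) * D $$ (k, j))"
      using ij D by (simp add: scalar_prod_def E_def)
    also have "\<dots> = (\<Sum>k\<in>{0..<n}. if i = k then c i * D $$ (i, j) else 0)"
      by (rule sum.cong) auto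
    also have "\<dots> = c i * D $$ (i, j)" using ij by (simp add: sum.delta)
    also have "\<dots> = 1\<^sub>m m $$ (i, j)"
      using diag ij D c[of i] by (auto simp: diagonal_mat_def D_def[symmetric] mult.commute)
    finally show "(E * D) $$ (i, j) = 1\<^sub>m m $$ (i, j)" .
  qed (use E D in auto)
  obtain Q' where Q': "Q' \<in> carrier_mat m m" "Q * Q' = 1\<^sub>m m" "Q' * Q = 1\<^sub>m m"
    using invertible_matE[OF Q(2,1)] by blast
  have EPA: "E * P * A \<in> carrier_mat m m" using E P A by auto
  have "E * P * A * Q = 1\<^sub>m m"
    using \<open>E * D = 1\<^sub>m m\<close> E P A Q
    by (simp add: D_def assoc_mult_mat[of _ m n _ n _ m] assoc_mult_mat[of _ n n _ m _ m]
          assoc_mult_mat[of _ m n _ m _ m])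
  then have "E * P * A = Q'"
    using assoc_mult_mat[OF EPA Q(1) Q'(1)] Q' right_mult_one_mat[OF EPA] by simp
  then have "(Q * (E * P)) * A = 1\<^sub>m m"
    using assoc_mult_mat[of Q m m "E * P" n A m] Q E P A Q'(2) by auto
  then show "left_invertible A"
    using left_invertibleI[OF A] Q E P by (metis mult_carrier_mat)
next
  assume "left_invertible A"
  then obtain P where P: "P \<in> carrier_mat n n" "invertible_mat P" "P * A = identity_columns n m"
    using left_invertible_reduces[OF A] by blast
  have one: "invertible_mat (1\<^sub>m m :: 'a mat)"
    by (rule invertible_matI[of _ m "1\<^sub>m m"]) auto
  have "identity_columns n m = P * A * 1\<^sub>m m"
    using P(3) by (simp add: right_mult_one_mat[OF identity_columns_carrier])
  then have "\<exists>P Q. P \<in> carrier_mat (dim_row A) (dim_row A) \<and> invertible_mat P \<and>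
      Q \<in> carrier_mat (dim_col A) (dim_col A) \<and> invertible_mat Q \<and>
      identity_columns n m = P * A * Q"
    using P(1,2) one A by - (rule exI[of _ P], rule exI[of _ "1\<^sub>m m"], simp)
  moreover have "diagonal_mat (identity_columns n m)"
    by (simp add: diagonal_mat_def identity_columns_def)
  moreover have "\<forall>i. Suc i < min (dim_row A) (dim_col A) \<longrightarrow>
      identity_columns n m $$ (i, i) dvd identity_columns n m $$ (Suc i, Suc i)"
    using A by (simp add: identity_columns_def)
  ultimately have "smith_normal_form A (identity_columns n m)"
    unfolding smith_normal_form_def by (intro conjI)
  then show "unit_smith_form A"
    unfolding unit_smith_form_def using A \<open>m \<le> n\<close>
    by (intro exI[of _ "identity_columns n m"]) (auto simp: identity_columns_def)
qed

end

section \<open>Counting over a finite local ring\<close>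

lemma card_carrier_vec_restricted:
  fixes S :: "'a::finite set"
  shows "card {v \<in> carrier_vec n. \<forall>i<n. v $ i \<in> S} = card S ^ n"
proof -
  have "bij_betw (Matrix.vec n) ({..<n} \<rightarrow>\<^sub>E S) {v \<in> carrier_vec n. \<forall>i<n. v $ i \<in> S}"
  proof (rule bij_betw_byWitness[where f' = "\<lambda>v. restrict (\<lambda>i. v $ i) {..<n}"])
    show "\<forall>f\<in>{..<n} \<rightarrow>\<^sub>E S. restrict (\<lambda>i. Matrix.vec n f $ i) {..<n} = f"
      by (auto simp: PiE_def extensional_def restrict_def)
    show "\<forall>v\<in>{v \<in> carrier_vec n. \<forall>i<n. v $ i \<in> S}. Matrix.vec n (restrict (\<lambda>i. v $ i) {..<n}) = v"
      by (auto intro!: eq_vecI)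
    show "Matrix.vec n ` ({..<n} \<rightarrow>\<^sub>E S) \<subseteq> {v \<in> carrier_vec n. \<forall>i<n. v $ i \<in> S}"
      by (auto simp: PiE_def Pi_def)
    show "(\<lambda>v. restrict (\<lambda>i. v $ i) {..<n}) ` {v \<in> carrier_vec n. \<forall>i<n. v $ i \<in> S} \<subseteq> {..<n} \<rightarrow>\<^sub>E S"
      by (simp add: image_subset_iff restrict_PiE_iff)
  qed
  then have "card {v \<in> carrier_vec n. \<forall>i<n. v $ i \<in> S} = card ({..<n} \<rightarrow>\<^sub>E S)"
    by (simp only: bij_betw_same_card)
  also have "\<dots> = card S ^ n"
    by (simp only: card_PiE finite_lessThan prod_constant card_lessThan)
  finally show ?thesis .
qed

text \<open>Matrices correspond to the functions underlying a random matrix, namely those that are zero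
  outside the index range; this yields the cardinality, and the uniformity of a random matrix.\<close>

lemma bij_betw_carrier_mat:
  "bij_betw (Matrix.mat n m) (PiE_dflt ({..<n} \<times> {..<m}) 0 (\<lambda>_. UNIV :: 'a::{finite,zero} set))
    (carrier_mat n m)"
proof (rule bij_betw_byWitness[where f' = "\<lambda>A ij. if ij \<in> {..<n} \<times> {..<m} then A $$ ij else 0"])
  show "\<forall>f\<in>PiE_dflt ({..<n} \<times> {..<m}) 0 (\<lambda>_. UNIV :: 'a set).
      (\<lambda>ij. if ij \<in> {..<n} \<times> {..<m} then Matrix.mat n m f $$ ij else 0) = f"
    by (auto simp: PiE_dflt_def fun_eq_iff)
qed (auto simp: PiE_dflt_def)

lemma finite_carrier_mat: "finite (carrier_mat n m :: 'a::{finite,zero} mat set)"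
  using bij_betw_finite[OF bij_betw_carrier_mat[of n m]] by auto

lemma card_carrier_mat: "card (carrier_mat n m :: 'a::{finite,zero} mat set) = CARD('a) ^ (n * m)"
  using bij_betw_same_card[OF bij_betw_carrier_mat[of n m, where 'a = 'a]]
  by (simp add: card_PiE_dflt)

lemma random_mat_eq_uniform:
  "random_mat n m = pmf_of_set (carrier_mat n m :: 'a::{finite,zero} mat set)"
proof -
  let ?F = "PiE_dflt ({..<n} \<times> {..<m}) 0 (\<lambda>_. UNIV :: 'a set)"
  have "(\<lambda>_. 0) \<in> ?F" by (auto simp: PiE_dflt_def)
  then have "map_pmf (Matrix.mat n m) (pmf_of_set ?F) = pmf_of_set (carrier_mat n m)"
    by (intro map_pmf_of_set_bij_betw[OF bij_betw_carrier_mat]) auto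
  then show ?thesis by (simp add: random_mat_def Pi_pmf_of_set)
qed

locale finite_local_ring = local_ring R for R :: "'a::{comm_ring_1,finite} itself"
begin

lemma card_vec_with_unit:
  "card {v \<in> carrier_vec n. \<exists>i<n. (v $ i :: 'a) dvd 1} =
    CARD('a) ^ n - card {x::'a. \<not> x dvd 1} ^ n"
proof -
  have "{v \<in> carrier_vec n. \<exists>i<n. (v $ i :: 'a) dvd 1} =
      carrier_vec n - {v \<in> carrier_vec n. \<forall>i<n. v $ i \<in> {x. \<not> x dvd 1}}"
    by auto
  then show ?thesis
    by (simp add: card_Diff_subset card_carrier_vec
        card_carrier_vec_restricted[of n "{x. \<not> x dvd 1}", simplified])
qed

text \<open>A left invertible matrix is determined by its first column $v$, which is any vector with a unit
  entry, by an arbitrary row $r$, and by a left invertible matrix $A$ with one row and one column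
  less: with an invertible $G_v$ chosen once for each $v$, it is the product of $G_v$ and the
  bordered matrix of $r$ and $A$.\<close>

lemma card_left_invertible_Suc:
  "card {A :: 'a mat. A \<in> carrier_mat (Suc n) (Suc m) \<and> left_invertible A} =
    (CARD('a) ^ Suc n - card {x::'a. \<not> x dvd 1} ^ Suc n) * CARD('a) ^ m *
    card {A :: 'a mat. A \<in> carrier_mat n m \<and> left_invertible A}"
proof -
  let ?U = "{v \<in> carrier_vec (Suc n). \<exists>i<Suc n. (v $ i :: 'a) dvd 1}"
  let ?L = "\<lambda>n m. {A :: 'a mat. A \<in> carrier_mat n m \<and> left_invertible A}"
  have "\<forall>v\<in>?U. \<exists>G. G \<in> carrier_mat (Suc n) (Suc n) \<and> invertible_mat G \<and> col G 0 = v"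
    using unit_entry_extends by blast
  from bchoice[OF this] obtain G where
      "\<forall>v\<in>?U. G v \<in> carrier_mat (Suc n) (Suc n) \<and> invertible_mat (G v) \<and> col (G v) 0 = v"
    by (elim exE)
  then have G: "\<And>v. v \<in> ?U \<Longrightarrow> G v \<in> carrier_mat (Suc n) (Suc n)"
      "\<And>v. v \<in> ?U \<Longrightarrow> invertible_mat (G v)" "\<And>v. v \<in> ?U \<Longrightarrow> col (G v) 0 = v"
    by simp_all
  let ?f = "\<lambda>(v, r, A). G v * bordered r A"
  \<comment> \<open>The first column of the product is $v$, so $v$ and then $r$ and $A$ can be recovered.\<close>
  have inj: "inj_on ?f (?U \<times> carrier_mat 1 m \<times> ?L n m)"
  proof (rule inj_onI)
    fix x y
    assume xy: "x \<in> ?U \<times> carrier_mat 1 m \<times> ?L n m" "y \<in> ?U \<times> carrier_mat 1 m \<times> ?L n m"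
      "?f x = ?f y"
    obtain v r A w s B where x: "x = (v, r, A)" and y: "y = (w, s, B)"
      by (cases x; cases y)
    have vU: "v \<in> ?U" and wU: "w \<in> ?U"
      and r: "r \<in> carrier_mat 1 m" and s: "s \<in> carrier_mat 1 m"
      and A: "A \<in> carrier_mat n m" and B: "B \<in> carrier_mat n m"
      and eq: "G v * bordered r A = G w * bordered s B"
      using xy by (simp_all add: x y)
    have col: "col (G v * bordered r A) 0 = v"
      if "v \<in> ?U" "A \<in> carrier_mat n m" for v r A
      using col_mult2[OF G(1)[OF that(1)] bordered_carrier[OF that(2)], of 0 r]
        col_bordered[OF that(2)] mult_mat_unit_vec[OF G(1)[OF that(1)], of 0] G(3)[OF that(1)]
      by simp
    have vw: "v = w" using col[OF vU A, of r] col[OF wU B, of s] eq by simp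
    obtain H where H: "H \<in> carrier_mat (Suc n) (Suc n)" "H * G v = 1\<^sub>m (Suc n)"
      using invertible_matE[OF G(2,1)[OF vU]] by blast
    have "bordered r A = H * (G v * bordered r A)"
      using assoc_mult_mat[OF H(1) G(1)[OF vU] bordered_carrier[OF A, of r]] H(2)
        bordered_carrier[OF A, of r] by simp
    also have "\<dots> = H * (G v * bordered s B)" using eq vw by simp
    also have "\<dots> = bordered s B"
      using assoc_mult_mat[OF H(1) G(1)[OF vU] bordered_carrier[OF B, of s]] H(2)
        bordered_carrier[OF B, of s] by simp
    finally show "x = y"
      using vw bordered_eq_iff[OF r A s B] by (simp add: x y)
  qed
  have image: "?f ` (?U \<times> carrier_mat 1 m \<times> ?L n m) = ?L (Suc n) (Suc m)"
  proof (intro equalityI subsetI)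
    fix M assume "M \<in> ?f ` (?U \<times> carrier_mat 1 m \<times> ?L n m)"
    then obtain v r A where *: "v \<in> ?U" "r \<in> carrier_mat 1 m" "A \<in> ?L n m" "M = G v * bordered r A"
      by auto
    then have A: "A \<in> carrier_mat n m" by simp
    show "M \<in> ?L (Suc n) (Suc m)"
      using * left_invertible_mult_left_iff[OF G(2,1)[OF *(1)] bordered_carrier[OF A]]
        left_invertible_bordered_iff[OF *(2) A] mult_carrier_mat[OF G(1)[OF *(1)] bordered_carrier[OF A]]
      by auto
  next
    fix M assume "M \<in> ?L (Suc n) (Suc m)"
    then have M: "M \<in> carrier_mat (Suc n) (Suc m)" "left_invertible M" by auto
    have v: "col M 0 \<in> ?U"
      using left_invertible_col_has_unit[OF M, of 0] col_carrier_vec[OF _ M(1), of 0] by auto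
    obtain r A where *: "r \<in> carrier_mat 1 m" "A \<in> carrier_mat n m"
        "M = G (col M 0) * bordered r A"
      using first_column_reduction[OF G(1,2)[OF v] M(1) G(3)[OF v]] by blast
    have "left_invertible A"
      using M(2) left_invertible_mult_left_iff[OF G(2,1)[OF v] bordered_carrier[OF *(2)]]
        left_invertible_bordered_iff[OF *(1,2)] *(3) by metis
    then show "M \<in> ?f ` (?U \<times> carrier_mat 1 m \<times> ?L n m)"
      using * v by (intro image_eqI[of _ _ "(col M 0, r, A)"]) auto
  qed
  have "card (?L (Suc n) (Suc m)) = card (?U \<times> (carrier_mat 1 m :: 'a mat set) \<times> ?L n m)"
    using card_image[OF inj] by (simp only: image)
  also have "\<dots> = card ?U * (card (carrier_mat 1 m :: 'a mat set) * card (?L n m))"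
    by (simp only: card_cartesian_product)
  finally show ?thesis by (simp only: card_vec_with_unit card_carrier_mat mult_1 mult.assoc)
qed

text \<open>Each of the $m$ columns contributes the probability that a random vector has a unit entry; the
  lengths of these vectors go down from $n+m$ to $n+1$.\<close>

lemma prob_left_invertible:
  "measure_pmf.prob (random_mat (n + m) m) {A :: 'a mat. left_invertible A} =
    (\<Prod>j=n+1..n+m. 1 - (real (card {x::'a. \<not> x dvd 1}) / real CARD('a)) ^ j)"
proof -
  let ?u = "card {x::'a. \<not> x dvd 1}" and ?q = "CARD('a)"
  let ?L = "\<lambda>n m. {A :: 'a mat. A \<in> carrier_mat n m \<and> left_invertible A}"
  have "real (card (?L (n + m) m)) = real ?q ^ ((n + m) * m) *
      (\<Prod>j=n+1..n+m. 1 - (real ?u / real ?q) ^ j)"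
  proof (induction m)
    case 0
    have "left_invertible A" if "A \<in> carrier_mat n 0" for A :: "'a mat"
      using that by (intro left_invertibleI[of A n 0 "0\<^sub>m 0 n"]) auto
    then have "?L n 0 = carrier_mat n 0" by auto
    then show ?case by (simp add: card_carrier_mat)
  next
    case (Suc m)
    have "?u \<le> ?q" by (rule card_mono) auto
    then have "real (?q ^ Suc (n + m) - ?u ^ Suc (n + m)) =
        real ?q ^ Suc (n + m) * (1 - (real ?u / real ?q) ^ Suc (n + m))"
      by (subst of_nat_diff[OF power_mono]) (simp_all add: power_divide right_diff_distrib del: power_Suc)
    then have "real (card (?L (n + Suc m) (Suc m))) =
        (real ?q ^ Suc (n + m) * (1 - (real ?u / real ?q) ^ Suc (n + m))) * real ?q ^ m *
        (real ?q ^ ((n + m) * m) * (\<Prod>j=n+1..n+m. 1 - (real ?u / real ?q) ^ j))"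
      by (simp only: add_Suc_right card_left_invertible_Suc of_nat_mult of_nat_power Suc.IH)
    moreover have "real ?q ^ ((n + Suc m) * Suc m) =
        real ?q ^ Suc (n + m) * real ?q ^ m * real ?q ^ ((n + m) * m)"
      unfolding power_add[symmetric] by (simp add: algebra_simps)
    moreover have "(\<Prod>j=n+1..n+Suc m. 1 - (real ?u / real ?q) ^ j) =
        (\<Prod>j=n+1..n+m. 1 - (real ?u / real ?q) ^ j) * (1 - (real ?u / real ?q) ^ Suc (n + m))"
      by simp
    ultimately show ?case by (simp only: mult_ac)
  qed
  moreover have "carrier_mat (n + m) m \<inter> {A :: 'a mat. left_invertible A} = ?L (n + m) m" by auto
  moreover have "carrier_mat (n + m) m \<noteq> ({} :: 'a mat set)"
    using zero_carrier_mat by blast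
  ultimately show ?thesis
    by (simp add: random_mat_eq_uniform measure_pmf_of_set finite_carrier_mat card_carrier_mat)
qed

lemma prob_unit_smith_form:
  "measure_pmf.prob (random_mat (n + m) m) {A :: 'a mat. unit_smith_form A} =
    (\<Prod>j=n+1..n+m. 1 - (real (card {x::'a. \<not> x dvd 1}) / real CARD('a)) ^ j)"
proof -
  have "measure_pmf.prob (random_mat (n + m) m) {A :: 'a mat. unit_smith_form A} =
      measure_pmf.prob (random_mat (n + m) m) {A :: 'a mat. left_invertible A}"
    using unit_smith_form_iff_left_invertible[of _ "n + m" m]
    by (intro measure_pmf.finite_measure_eq_AE AE_pmfI)
      (auto simp: random_mat_def)
  then show ?thesis by (simp add: prob_left_invertible)
qed

lemma prob_nonsingular:
  "measure_pmf.prob (random_mat k k) {A :: 'a mat. nonsingular A} =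
    measure_pmf.prob (random_mat k k) {A :: 'a mat. unit_smith_form A}"
  by (intro measure_pmf.finite_measure_eq_AE AE_pmfI) (auto simp: random_mat_def nonsingular_def)

end

section \<open>The ring of integers modulo a prime power\<close>

lemma mod_ring_dvd_1_iff_coprime:
  fixes x :: "'r::nontriv mod_ring"
  shows "x dvd 1 \<longleftrightarrow> algebraic_semidom_class.coprime (to_int_mod_ring x) (int CARD('r))"
proof -
  have "x dvd 1 \<longleftrightarrow> (\<exists>k\<in>{0..<int CARD('r)}. 1 = to_int_mod_ring x * k mod int CARD('r))"
    by transfer simp
  also have "\<dots> \<longleftrightarrow> algebraic_semidom_class.coprime (to_int_mod_ring x) (int CARD('r))"
    by (subst coprime_iff_invertible'_int) (auto simp: cong_def)
  finally show ?thesis .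
qed

lemma mod_ring_nonunit_iff:
  fixes x :: "'r::nontriv mod_ring"
  assumes "prime p" "s \<ge> 1" "CARD('r) = p ^ s"
  shows "\<not> x dvd 1 \<longleftrightarrow> int p dvd to_int_mod_ring x"
proof -
  have "algebraic_semidom_class.coprime (to_int_mod_ring x) (int p) \<longleftrightarrow> \<not> int p dvd to_int_mod_ring x"
    using assms(1) prime_imp_coprime[of "int p" "to_int_mod_ring x"]
      coprime_common_divisor[of "to_int_mod_ring x" "int p" "int p"]
    by (auto simp: algebraic_semidom_class.coprime_commute)
  then show ?thesis
    using assms by (simp add: mod_ring_dvd_1_iff_coprime)
qed

lemma card_mod_ring_nonunits:
  assumes "prime p" "s \<ge> 1" "CARD('r::nontriv) = p ^ s"
  shows "card {x :: 'r mod_ring. \<not> x dvd 1} = p ^ (s - 1)"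
proof -
  have ps: "int CARD('r) = int p * int p ^ (s - 1)"
    using assms by (cases s) auto
  have p: "int p > 0" using assms(1) prime_gt_0_nat by simp
  have inj: "inj (to_int_mod_ring :: 'r mod_ring \<Rightarrow> int)"
    by (metis injI of_int_mod_ring_to_int_mod_ring)
  have "to_int_mod_ring ` {x :: 'r mod_ring. \<not> x dvd 1} =
      {t \<in> {0..<int CARD('r)}. int p dvd t}"
    using mod_ring_nonunit_iff[OF assms] range_to_int_mod_ring[where 'a = 'r] by auto
  also have "\<dots> = (\<lambda>k. int p * k) ` {0..<int p ^ (s - 1)}"
    using p by (auto simp: ps elim!: dvdE simp: zero_le_mult_iff)
  finally have "card (to_int_mod_ring ` {x :: 'r mod_ring. \<not> x dvd 1}) =
      card ((\<lambda>k. int p * k) ` {0..<int p ^ (s - 1)})" by simp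
  also have "\<dots> = p ^ (s - 1)"
    using p by (subst card_image) (auto simp: inj_on_def nat_power_eq)
  finally show ?thesis by (simp add: card_image inj_on_subset[OF inj])
qed

text \<open>The nonunits are the multiples of $p$; as $p$ divides the modulus, reducing a sum of two of them
  gives another one.\<close>

lemma mod_ring_finite_local_ring:
  assumes "prime p" "s \<ge> 1" "CARD('r::nontriv) = p ^ s"
  shows "finite_local_ring TYPE('r mod_ring)"
proof unfold_locales
  fix x y :: "'r mod_ring"
  have "int p dvd int CARD('r)" using assms by simp
  then show "\<not> x + y dvd 1" if "\<not> x dvd 1" "\<not> y dvd 1"
    using that by (simp add: mod_ring_nonunit_iff[OF assms] to_int_mod_ring_add dvd_mod_iff)
qed

lemma prob_unit_smith_form_mod_ring:
  assumes "prime p" "s \<ge> 1" "CARD('r::nontriv) = p ^ s"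
  shows "measure_pmf.prob (random_mat (n + m) m) {A :: 'r mod_ring mat. unit_smith_form A} =
    (\<Prod>j=n+1..n+m. 1 - 1 / real p ^ j)"
proof -
  interpret finite_local_ring "TYPE('r mod_ring)"
    by (rule mod_ring_finite_local_ring[OF assms])
  have "real (p ^ (s - 1)) / real (p ^ s) = 1 / real p"
    using assms prime_gt_0_nat[OF assms(1)] by (cases s) auto
  then show ?thesis
    using prob_unit_smith_form[of n m]
    by (simp add: card_mod_ring_nonunits[OF assms] assms(3) power_divide)
qed

section \<open>The probability of a unit Smith form\<close>

theorem theorem5p5:
  fixes p m n :: nat
  assumes "prime p" and "m \<ge> 1"
  shows
    "f0 p m n = (\<Prod>j = n + 1..n + m. 1 - 1 / real p ^ j)
   \<and> (\<forall>q. prime q \<and> p < q \<longrightarrow> f0 p m n < f0 q m n)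
   \<and> (\<forall>n'. n < n' \<longrightarrow> f0 p m n < f0 p m n')
   \<and> (\<forall>m'. m < m' \<longrightarrow> f0 p m' n < f0 p m n)
   \<and> (\<lambda>k. f0 p k n) \<longlonglongrightarrow> qbr_inf p / qbr p n
   \<and> qbr_inf p / qbr p n < 1
   \<and> (\<lambda>k. INF i\<in>{1..}. f0 p i k) \<longlonglongrightarrow> 1
   \<and> ((\<lambda>q. INF (i, k)\<in>{1..} \<times> UNIV. f0 q i k) \<longlongrightarrow> 1) primes_at_top
   \<and> (\<lambda>k. f0 p k 0) \<longlonglongrightarrow> qbr_inf p
   \<and> (\<lambda>k. f0 p m k) \<longlonglongrightarrow> 1
   \<and> ((\<lambda>q. f0 q m n) \<longlongrightarrow> 1) primes_at_top
   \<and> (\<forall>s \<ge> 1. CARD('r::nontriv) = p ^ s \<longrightarrow>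
        measure_pmf.prob (random_mat (n + m) m :: 'r mod_ring mat pmf) {A. unit_smith_form A} = f0 p m n
      \<and> (\<lambda>k. measure_pmf.prob (random_mat k k :: 'r mod_ring mat pmf) {A. nonsingular A})
          \<longlonglongrightarrow> qbr_inf p)"
proof -
  have p: "p \<ge> 2" using assms(1) by (rule prime_ge_2_nat)
  have C: "(\<lambda>k. f0 p k 0) \<longlonglongrightarrow> qbr_inf p"
    using f0_tendsto_m[OF p, of 0] by (simp add: qbr_def)
  have prob: "measure_pmf.prob (random_mat (l + k) k :: 'r mod_ring mat pmf) {A. unit_smith_form A} =
      f0 p k l" if "s \<ge> 1" "CARD('r::nontriv) = p ^ s" for s k l
    using prob_unit_smith_form_mod_ring[OF assms(1) that, of l k] f0_eq_prod[OF p] by simp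
  have nonsing: "(\<lambda>k. measure_pmf.prob (random_mat k k :: 'r mod_ring mat pmf) {A. nonsingular A})
      \<longlonglongrightarrow> qbr_inf p" if s: "s \<ge> 1" "CARD('r::nontriv) = p ^ s" for s
  proof -
    interpret finite_local_ring "TYPE('r mod_ring)"
      by (rule mod_ring_finite_local_ring[OF assms(1) s])
    show ?thesis
      using C prob[OF s, of 0] by (simp add: prob_nonsingular)
  qed
  show ?thesis
    using f0_eq_prod[OF p, of m n] f0_strict_mono_p[OF p _ assms(2)] f0_strict_mono_n[OF p _ assms(2)]
      f0_strict_antimono_m[OF p] f0_tendsto_m[OF p, of n] qbr_ratio_less_1[OF p, of n]
      INF_f0_tendsto_n[OF p] INF_f0_tendsto_p C f0_tendsto_n[OF p, of m] f0_tendsto_p[of m n]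
      prob[of _ n m] nonsing
    by (intro conjI allI impI) (assumption | blast)+
qed

end
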